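(* Let $\mathscr{K}_3$ be the plane curve over $\mathbb{Q}$ defined by $$8x^8-32x^6y+40x^4y^2+64x^5-16x^2y^3-128x^3y+y^4+48xy^2+96x^2-32y-24=0,$$ and let $\mathscr{K}_s$ be the curve over $\mathbb{Q}$ defined by $$w^2=2z(z^4+4z^3-2z^2+4z+1).$$ Then $\mathscr{K}_3$ and $\mathscr{K}_s$ are birationally isomorphic over $\mathbb{Q}$.
   Context: Two (irreducible) curves over $\mathbb{Q}$ are birationally isomorphic over $\mathbb{Q}$ if there are mutually inverse rational maps between them defined over $\mathbb{Q}$, equivalently if their function fields are isomorphic over $\mathbb{Q}$. *)

theory Defs
  imports
    "HOL-Algebra.QuotRing"
    "HOL-Computational_Algebra.Fraction_Field"
    "HOL-Computational_Algebra.Polynomial_Factorial"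
    "HOL-Computational_Algebra.Field_as_Ring"
begin

text \<open>
  A plane curve over the rationals is given by its defining polynomial in two variables, an element
  of \<^typ>\<open>rat poly poly\<close>: the first variable is the variable of the coefficient ring
  \<^typ>\<open>rat poly\<close>, the second one is the outer variable.
\<close>

type_synonym plane_curve = "rat poly poly"

definition var1 :: "rat poly poly" where
  "var1 = [:[:0, 1:]:]"

definition var2 :: "rat poly poly" where
  "var2 = [:0, 1:]"

text \<open>
  For irreducible \<open>f\<close>, the function field of the curve \<open>f = 0\<close> is the field of fractions of
  \<open>\<rat>[x,y]/(f)\<close>.  Its elements are the restrictions to the curve of those rational functions
  \<open>a/b\<close> in \<open>\<rat>(x,y)\<close> whose denominator does not vanish identically on the curve; that is, it is
  the localisation of \<open>\<rat>[x,y]\<close> at the prime ideal \<open>(f)\<close> modulo its maximal ideal.  (Note that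
  \<open>\<not> f dvd b\<close> implies \<open>b \<noteq> 0\<close>.)
\<close>

definition local_ring :: "plane_curve \<Rightarrow> rat poly poly fract ring" where
  "local_ring f =
     \<lparr>carrier = {Fract a b | a b. \<not> f dvd b}, monoid.mult = (*), one = 1, zero = 0, add = (+)\<rparr>"

definition vanishing_ideal :: "plane_curve \<Rightarrow> rat poly poly fract set" where
  "vanishing_ideal f = {Fract a b | a b. f dvd a \<and> \<not> f dvd b}"

definition function_field :: "plane_curve \<Rightarrow> rat poly poly fract set ring" where
  "function_field f = local_ring f Quot vanishing_ideal f"

definition restrict_to_curve ::
  "plane_curve \<Rightarrow> rat poly poly fract \<Rightarrow> rat poly poly fract set" where
  "restrict_to_curve f r = vanishing_ideal f +>\<^bsub>local_ring f\<^esub> r"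

definition const_on_curve :: "plane_curve \<Rightarrow> rat \<Rightarrow> rat poly poly fract set" where
  "const_on_curve f c = restrict_to_curve f (Fract [:[:c:]:] 1)"

definition birational_over_Q :: "plane_curve \<Rightarrow> plane_curve \<Rightarrow> bool" where
  "birational_over_Q f g \<longleftrightarrow>
     Factorial_Ring.irreducible f \<and> Factorial_Ring.irreducible g \<and>
     (\<exists>h \<in> ring_iso (function_field f) (function_field g).
        \<forall>c. h (const_on_curve f c) = const_on_curve g c)"

definition K3 :: plane_curve where
  "K3 = (let x = var1; y = var2 in
     8*x^8 - 32*x^6*y + 40*x^4*y^2 + 64*x^5 - 16*x^2*y^3 - 128*x^3*y + y^4
       + 48*x*y^2 + 96*x^2 - 32*y - 24)"

definition Ks :: plane_curve where
  "Ks = (let z = var1; w = var2 in w^2 - 2*z*(z^4 + 4*z^3 - 2*z^2 + 4*z + 1))"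


text \<open>The construction does yield a field in which \<open>f\<close> vanishes.\<close>

lemma irreducible_dvd_mult_iff:
  fixes f :: plane_curve
  assumes "Factorial_Ring.irreducible f"
  shows "f dvd a * b \<longleftrightarrow> f dvd a \<or> f dvd b"
  by (rule prime_elem_dvd_mult_iff[OF irreducible_imp_prime_elem[OF assms]])

lemma Fract_in_vanishing_ideal:
  "f dvd a \<Longrightarrow> \<not> f dvd b \<Longrightarrow> Fract a b \<in> vanishing_ideal f"
  unfolding vanishing_ideal_def by blast

lemma Fract_in_vanishing_ideal_iff:
  assumes "Factorial_Ring.irreducible f" "\<not> f dvd b"
  shows "Fract a b \<in> vanishing_ideal f \<longleftrightarrow> f dvd a"
proof
  assume "Fract a b \<in> vanishing_ideal f"
  then obtain c d where cd: "Fract a b = Fract c d" "f dvd c" "\<not> f dvd d"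
    by (auto simp: vanishing_ideal_def)
  have nz: "b \<noteq> 0" "d \<noteq> 0" using assms cd by auto
  with cd(1) have "a * d = c * b" by (simp add: eq_fract)
  then have "f dvd a * d" using cd(2) by simp
  then show "f dvd a" using assms(1) cd(3) irreducible_dvd_mult_iff by blast
qed (use assms in \<open>auto simp: vanishing_ideal_def\<close>)

lemma local_ring_cring:
  assumes "Factorial_Ring.irreducible f"
  shows "cring (local_ring f)"
proof -
  have u: "\<not> f dvd 1" using assms by (simp add: Factorial_Ring.irreducible_def)
  have nz: "b \<noteq> 0" if "\<not> f dvd b" for b using that by auto
  have add: "r + s \<in> carrier (local_ring f)" and mul: "r * s \<in> carrier (local_ring f)"
    if rs: "r \<in> carrier (local_ring f)" "s \<in> carrier (local_ring f)" for r s
  proof -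
    obtain a b c d where e: "r = Fract a b" "s = Fract c d" "\<not> f dvd b" "\<not> f dvd d"
      using rs by (auto simp: local_ring_def)
    have "\<not> f dvd b * d" using e assms irreducible_dvd_mult_iff by blast
    moreover have "r + s = Fract (a * d + c * b) (b * d)" "r * s = Fract (a * c) (b * d)"
      using e nz by auto
    ultimately show "r + s \<in> carrier (local_ring f)" "r * s \<in> carrier (local_ring f)"
      by (auto simp: local_ring_def)
  qed
  have um: "- r \<in> carrier (local_ring f)" if "r \<in> carrier (local_ring f)" for r
    using that by (force simp: local_ring_def)
  have z: "0 \<in> carrier (local_ring f)" and o: "1 \<in> carrier (local_ring f)"
    using u by (auto simp: local_ring_def Zero_fract_def One_fract_def)
  show ?thesis
  proof (rule cringI)
    show "abelian_group (local_ring f)"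
    proof (rule abelian_groupI)
      fix r assume "r \<in> carrier (local_ring f)"
      then show "\<exists>s\<in>carrier (local_ring f). s \<oplus>\<^bsub>local_ring f\<^esub> r = \<zero>\<^bsub>local_ring f\<^esub>"
        by (intro bexI[of _ "- r"]) (auto simp: um, simp add: local_ring_def)
    qed (use add z in \<open>simp_all add: local_ring_def algebra_simps\<close>)
    show "Group.comm_monoid (local_ring f)"
      by (rule comm_monoidI) (use mul o in \<open>simp_all add: local_ring_def algebra_simps\<close>)
  qed (simp add: local_ring_def algebra_simps)
qed

lemma vanishing_ideal_maximalideal:
  assumes "Factorial_Ring.irreducible f"
  shows "maximalideal (vanishing_ideal f) (local_ring f)"
proof -
  interpret R: cring "local_ring f" by (rule local_ring_cring[OF assms])
  have u: "\<not> f dvd 1" using assms by (simp add: Factorial_Ring.irreducible_def)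
  have nz: "b \<noteq> 0" if "\<not> f dvd b" for b using that by auto
  have sub: "vanishing_ideal f \<subseteq> carrier (local_ring f)"
    by (auto simp: vanishing_ideal_def local_ring_def)
  have z: "0 \<in> vanishing_ideal f"
    using u Fract_in_vanishing_ideal[of f 0 1] by (simp add: Zero_fract_def)
  have add: "r + s \<in> vanishing_ideal f"
    if rs: "r \<in> vanishing_ideal f" "s \<in> vanishing_ideal f" for r s
  proof -
    obtain a b c d where e: "r = Fract a b" "s = Fract c d" "\<not> f dvd b" "\<not> f dvd d"
        "f dvd a" "f dvd c"
      using rs by (auto simp: vanishing_ideal_def)
    have "\<not> f dvd b * d" using e assms irreducible_dvd_mult_iff by blast
    moreover have "f dvd a * d + c * b" using e by simp
    moreover have "r + s = Fract (a * d + c * b) (b * d)" using e nz by auto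
    ultimately show ?thesis using Fract_in_vanishing_ideal by metis
  qed
  have mul: "r * s \<in> vanishing_ideal f"
    if rs: "r \<in> vanishing_ideal f" "s \<in> carrier (local_ring f)" for r s
  proof -
    obtain a b c d where e: "r = Fract a b" "s = Fract c d" "\<not> f dvd b" "\<not> f dvd d" "f dvd a"
      using rs by (auto simp: vanishing_ideal_def local_ring_def)
    have "\<not> f dvd b * d" using e assms irreducible_dvd_mult_iff by blast
    moreover have "f dvd a * c" using e by simp
    moreover have "r * s = Fract (a * c) (b * d)" using e nz by auto
    ultimately show ?thesis using Fract_in_vanishing_ideal by metis
  qed
  have uminus: "\<ominus>\<^bsub>local_ring f\<^esub> r = - r" if "r \<in> carrier (local_ring f)" for r
  proof -
    have "- r \<in> carrier (local_ring f)" using that by (force simp: local_ring_def)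
    then show ?thesis using that by (intro R.minus_equality) (auto simp: local_ring_def)
  qed
  have one: "\<one>\<^bsub>local_ring f\<^esub> \<notin> vanishing_ideal f"
    using Fract_in_vanishing_ideal_iff[OF assms u, of 1] u
    by (simp add: local_ring_def One_fract_def)
  have ideal: "ideal (vanishing_ideal f) (local_ring f)"
  proof (rule idealI)
    show "subgroup (vanishing_ideal f) (add_monoid (local_ring f))"
    proof (rule subgroup.intro)
      fix r assume r: "r \<in> vanishing_ideal f"
      obtain a b where "r = Fract a b" "f dvd a" "\<not> f dvd b"
        using r by (auto simp: vanishing_ideal_def)
      then have "- r \<in> vanishing_ideal f" using Fract_in_vanishing_ideal[of f "- a" b] by simp
      then show "inv\<^bsub>add_monoid (local_ring f)\<^esub> r \<in> vanishing_ideal f"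
        using uminus[of r] r sub by (auto simp: a_inv_def)
    next
      show "vanishing_ideal f \<subseteq> carrier (add_monoid (local_ring f))" using sub by simp
    next
      show "\<one>\<^bsub>add_monoid (local_ring f)\<^esub> \<in> vanishing_ideal f" using z by (simp add: local_ring_def)
    next
      fix r s assume "r \<in> vanishing_ideal f" "s \<in> vanishing_ideal f"
      from add[OF this] show "r \<otimes>\<^bsub>add_monoid (local_ring f)\<^esub> s \<in> vanishing_ideal f"
        by (simp add: local_ring_def)
    qed
  next
    fix r s assume rs: "r \<in> vanishing_ideal f" "s \<in> carrier (local_ring f)"
    show "s \<otimes>\<^bsub>local_ring f\<^esub> r \<in> vanishing_ideal f" "r \<otimes>\<^bsub>local_ring f\<^esub> s \<in> vanishing_ideal f"
      using mul[OF rs] by (simp_all add: local_ring_def mult.commute)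
  qed (rule R.ring_axioms)
  show ?thesis
  proof (rule maximalidealI[OF ideal])
    show "carrier (local_ring f) \<noteq> vanishing_ideal f" using one R.one_closed by metis
  next
    fix J assume J: "ideal J (local_ring f)" "vanishing_ideal f \<subseteq> J" "J \<subseteq> carrier (local_ring f)"
    interpret J: ideal J "local_ring f" by (rule J(1))
    show "J = vanishing_ideal f \<or> J = carrier (local_ring f)"
    proof (rule disjCI)
      assume "J \<noteq> carrier (local_ring f)"
      have False if r: "r \<in> J" "r \<notin> vanishing_ideal f" for r
      proof -
        obtain a b where e: "r = Fract a b" "\<not> f dvd b" using r J(3) by (auto simp: local_ring_def)
        with r have a: "\<not> f dvd a" by (auto simp: vanishing_ideal_def)
        then have "Fract b a \<in> carrier (local_ring f)" by (auto simp: local_ring_def)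
        from J.I_l_closed[OF r(1) this] have "Fract b a * r \<in> J"
          by (simp add: local_ring_def)
        moreover have "Fract b a * r = \<one>\<^bsub>local_ring f\<^esub>"
          using nz[OF a] nz[OF e(2)] e(1) by (simp add: local_ring_def One_fract_def eq_fract)
        ultimately have "\<one>\<^bsub>local_ring f\<^esub> \<in> J" by simp
        then show False using J.one_imp_carrier \<open>J \<noteq> carrier (local_ring f)\<close> by blast
      qed
      then show "J = vanishing_ideal f" using J(2) by blast
    qed
  qed
qed

lemma function_field_is_field:
  assumes "Factorial_Ring.irreducible f"
  shows "field (function_field f)"
  unfolding function_field_def
  by (rule maximalideal.quotient_is_field[OF vanishing_ideal_maximalideal[OF assms]
        local_ring_cring[OF assms]])

lemma restrict_to_curve_eq_zero_iff:
  assumes "Factorial_Ring.irreducible f" "\<not> f dvd b"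
  shows "restrict_to_curve f (Fract a b) = \<zero>\<^bsub>function_field f\<^esub> \<longleftrightarrow> f dvd a"
proof -
  interpret I: maximalideal "vanishing_ideal f" "local_ring f"
    by (rule vanishing_ideal_maximalideal[OF assms(1)])
  have c: "Fract a b \<in> carrier (local_ring f)" using assms by (auto simp: local_ring_def)
  have "restrict_to_curve f (Fract a b) = \<zero>\<^bsub>function_field f\<^esub> \<longleftrightarrow> Fract a b \<in> vanishing_ideal f"
    unfolding restrict_to_curve_def function_field_def FactRing_def
    using I.a_rcos_const I.a_rcos_self[OF c] by auto
  then show ?thesis using Fract_in_vanishing_ideal_iff[OF assms] by simp
qed

end

theory Submission
  imports Defs
begin

text \<open>
  The seven nodes of \<open>K3\<close> lie on a pencil of curves \<open>P1 + t P2 = 0\<close> of weighted degree four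
  (\<open>x\<close> of weight one, \<open>y\<close> of weight two); the ratio \<open>P1 / P2\<close> is the hyperelliptic map of the
  genus two curve \<open>K3\<close>, and \<open>z = - (P1 + P2) / P2\<close> puts the branch points where \<open>Ks\<close> has them.
  Conversely \<open>x = (A(z) + B(z) w) / C(z)\<close> and \<open>y = T(x,z) / (z + 3)\<close>.
  Substituting these expressions maps \<open>\<rat>[x,y]\<close> to the function field of \<open>Ks\<close> and kills \<open>K3\<close>.
  If the kernel were larger than \<open>(K3)\<close>, then \<open>x\<close> would be algebraic over \<open>\<rat>\<close>, but \<open>x\<close> has a pole
  on \<open>Ks\<close>.  The formula for \<open>z\<close>, together with \<open>w = (C(z) x - A(z)) / B(z)\<close>, gives surjectivity.
\<close>

section \<open>Evaluation homomorphisms\<close>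

text \<open>Homomorphisms between whole types, without carrier sets, so that rewriting with
  \<open>simps\<close> pushes evaluations through concrete polynomials.\<close>

locale ring_map =
  fixes h :: "'a::comm_ring_1 \<Rightarrow> 'b::comm_ring_1"
  assumes add: "h (a + b) = h a + h b"
    and mult: "h (a * b) = h a * h b"
    and one: "h 1 = 1"
begin

lemma zero: "h 0 = 0"
  using add[of 0 0] by simp

lemma uminus: "h (- a) = - h a"
  using add[of a "- a"] by (simp add: zero eq_neg_iff_add_eq_0 add.commute)

lemma diff: "h (a - b) = h a - h b"
  using add[of a "- b"] by (simp add: uminus)

lemma power: "h (a ^ n) = h a ^ n"
  by (induction n) (simp_all add: one mult)

lemma numeral: "h (numeral n) = numeral n"
proof -
  have "h (of_nat m) = of_nat m" for m
    by (induction m) (simp_all add: zero one add)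
  from this[of "numeral n"] show ?thesis by simp
qed

lemmas simps = add mult one zero uminus diff power numeral

lemma poly_map_poly_pCons: "poly (map_poly h (pCons a p)) x = h a + x * poly (map_poly h p) x"
  by (simp add: map_poly_pCons zero)

lemma poly_map_poly_add:
  "poly (map_poly h (p + q)) x = poly (map_poly h p) x + poly (map_poly h q) x"
  by (induction p q rule: poly_induct2)
     (simp_all add: poly_map_poly_pCons simps algebra_simps)

lemma poly_map_poly_smult: "poly (map_poly h (smult a p)) x = h a * poly (map_poly h p) x"
  by (induction p) (simp_all add: poly_map_poly_pCons simps algebra_simps)

lemma ring_map_poly: "ring_map (\<lambda>p. poly (map_poly h p) x)"
proof
  show "poly (map_poly h (p * q)) x = poly (map_poly h p) x * poly (map_poly h q) x" for p q
    by (induction p)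
       (simp_all add: poly_map_poly_pCons poly_map_poly_add poly_map_poly_smult simps algebra_simps)
qed (simp_all add: poly_map_poly_add one map_poly_1)

lemma ring_map_map_poly: "ring_map (map_poly h)"
proof
  show add': "map_poly h (p + q) = map_poly h p + map_poly h q" for p q
    by (rule poly_eqI) (simp add: coeff_map_poly zero add)
  show "map_poly h (p * q) = map_poly h p * map_poly h q" for p q
    by (induction p)
       (simp_all add: map_poly_pCons map_poly_smult add' simps algebra_simps)
qed (simp add: one map_poly_1)

end

text \<open>\<open>h\<close> embeds the constants: it is \<open>of_rat\<close> at real points and
  the inclusion of constant fractions for the substitution of rational functions.\<close>

definition eval2 :: "(rat \<Rightarrow> 'a::comm_ring_1) \<Rightarrow> 'a \<Rightarrow> 'a \<Rightarrow> rat poly poly \<Rightarrow> 'a" where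
  "eval2 h x y p = poly (map_poly (\<lambda>c. poly (map_poly h c) x) p) y"

lemma (in ring_map) map_poly_const: "map_poly h [:c:] = [:h c:]"
  by (simp add: map_poly_pCons zero)

context
  fixes h :: "rat \<Rightarrow> 'a::comm_ring_1"
  assumes h: "ring_map h"
begin

lemma ring_map_eval2: "ring_map (eval2 h x y)"
  unfolding eval2_def by (intro ring_map.ring_map_poly h)

lemma eval2_const_poly: "eval2 h x y [:c:] = poly (map_poly h c) x"
  by (simp add: eval2_def ring_map.map_poly_const[OF ring_map.ring_map_poly[OF h]])

lemma eval2_const: "eval2 h x y [:[:c:]:] = h c"
  by (simp add: eval2_const_poly ring_map.map_poly_const[OF h])

lemma eval2_var1: "eval2 h x y var1 = x"
  by (simp add: var1_def eval2_const_poly map_poly_pCons ring_map.zero[OF h] ring_map.one[OF h])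

lemma eval2_var2: "eval2 h x y var2 = y"
proof -
  interpret e: ring_map "\<lambda>c. poly (map_poly h c) x" by (rule ring_map.ring_map_poly[OF h])
  show ?thesis by (simp add: var2_def eval2_def map_poly_pCons e.simps ring_map.one[OF h])
qed

end

text \<open>Horner's scheme, first for the coefficients and then for the outer variable, builds
  every polynomial from constants and the two variables.\<close>

lemma poly_poly_induct [case_names const add mult var1 var2]:
  assumes const: "\<And>c. P [:[:c:]:]" and add: "\<And>p q. P p \<Longrightarrow> P q \<Longrightarrow> P (p + q)"
    and mult: "\<And>p q. P p \<Longrightarrow> P q \<Longrightarrow> P (p * q)" and v1: "P var1" and v2: "P var2"
  shows "P p"
proof -
  have c: "P [:q:]" for q
  proof (induction q)
    case 0
    show ?case using const[of 0] by simp
  next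
    case (pCons a q)
    have "[:pCons a q:] = [:[:a:]:] + var1 * [:q:]" by (simp add: var1_def)
    then show ?case using pCons by (metis const add mult v1)
  qed
  show ?thesis
  proof (induction p)
    case 0
    show ?case using const[of 0] by simp
  next
    case (pCons a p)
    have "pCons a p = [:a:] + var2 * p" by (simp add: var2_def)
    then show ?case using pCons by (metis c add mult v2)
  qed
qed

section \<open>Local rings and vanishing ideals\<close>

lemma local_ring_simps:
  "monoid.mult (local_ring f) = (*)" "one (local_ring f) = 1" "zero (local_ring f) = 0"
  "add (local_ring f) = (+)"
  by (simp_all add: local_ring_def)

lemma const_in_local_ring:
  assumes "Factorial_Ring.irreducible f"
  shows "Fract a 1 \<in> carrier (local_ring f)"
  using assms by (auto simp: local_ring_def Factorial_Ring.irreducible_def)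

context
  fixes f :: plane_curve
  assumes f: "Factorial_Ring.irreducible f"
begin

interpretation R: cring "local_ring f" by (rule local_ring_cring[OF f])
interpretation I: maximalideal "vanishing_ideal f" "local_ring f"
  by (rule vanishing_ideal_maximalideal[OF f])

lemmas local_ring_closed =
  R.m_closed[unfolded local_ring_simps] R.a_closed[unfolded local_ring_simps]
  R.one_closed[unfolded local_ring_simps] R.zero_closed[unfolded local_ring_simps]

lemma local_ring_uminus: "r \<in> carrier (local_ring f) \<Longrightarrow> - r \<in> carrier (local_ring f)"
  by (force simp: local_ring_def)

lemma local_ring_diff:
  "r \<in> carrier (local_ring f) \<Longrightarrow> s \<in> carrier (local_ring f) \<Longrightarrow> r - s \<in> carrier (local_ring f)"
  using local_ring_closed(2)[OF _ local_ring_uminus, of r s] by simp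

lemma local_ring_inverse:
  assumes "r \<in> carrier (local_ring f)" "r \<notin> vanishing_ideal f"
  shows "inverse r \<in> carrier (local_ring f)"
proof -
  obtain a b where "r = Fract a b" "\<not> f dvd b" "\<not> f dvd a"
    using assms by (auto simp: local_ring_def vanishing_ideal_def)
  then show ?thesis by (auto simp: local_ring_def)
qed

lemma vanishing_ideal_subset: "r \<in> vanishing_ideal f \<Longrightarrow> r \<in> carrier (local_ring f)"
  by (auto simp: vanishing_ideal_def local_ring_def)

lemma vanishing_ideal_zero: "0 \<in> vanishing_ideal f"
  using I.zero_closed by (simp add: local_ring_simps)

lemma vanishing_ideal_add:
  "r \<in> vanishing_ideal f \<Longrightarrow> s \<in> vanishing_ideal f \<Longrightarrow> r + s \<in> vanishing_ideal f"
  using I.a_closed by (simp add: local_ring_simps)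

lemma vanishing_ideal_mult:
  "r \<in> vanishing_ideal f \<Longrightarrow> s \<in> carrier (local_ring f) \<Longrightarrow> s * r \<in> vanishing_ideal f"
  using I.I_l_closed by (simp add: local_ring_simps)

lemma vanishing_ideal_uminus: "r \<in> vanishing_ideal f \<Longrightarrow> - r \<in> vanishing_ideal f"
  using vanishing_ideal_mult[OF _ local_ring_uminus[OF local_ring_closed(3)], of r] by simp

lemma vanishing_ideal_diff:
  "r \<in> vanishing_ideal f \<Longrightarrow> s \<in> vanishing_ideal f \<Longrightarrow> r - s \<in> vanishing_ideal f"
  using vanishing_ideal_add[OF _ vanishing_ideal_uminus, of r s] by simp

lemma to_fract_in_vanishing_ideal_iff: "to_fract a \<in> vanishing_ideal f \<longleftrightarrow> f dvd a"
proof -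
  have "\<not> f dvd 1" using f by (simp add: Factorial_Ring.irreducible_def)
  from Fract_in_vanishing_ideal_iff[OF f this, of a] show ?thesis by (simp add: to_fract_def)
qed

lemma to_fract_in_local_ring: "to_fract a \<in> carrier (local_ring f)"
  unfolding to_fract_def by (rule const_in_local_ring[OF f])

lemma restrict_to_curve_hom:
  "ring_hom_ring (local_ring f) (function_field f) (restrict_to_curve f)"
  using I.rcos_ring_hom_ring by (simp add: restrict_to_curve_def[abs_def] function_field_def)

lemma restrict_to_curve_zero_iff:
  assumes "r \<in> carrier (local_ring f)"
  shows "restrict_to_curve f r = \<zero>\<^bsub>function_field f\<^esub> \<longleftrightarrow> r \<in> vanishing_ideal f"
proof -
  obtain a b where "r = Fract a b" "\<not> f dvd b" using assms by (auto simp: local_ring_def)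
  then show ?thesis
    using restrict_to_curve_eq_zero_iff[OF f] Fract_in_vanishing_ideal_iff[OF f] by simp
qed

lemma restrict_to_curve_cong:
  assumes "r - s \<in> vanishing_ideal f" "s \<in> carrier (local_ring f)"
  shows "restrict_to_curve f r = restrict_to_curve f s"
proof -
  interpret P: ring_hom_ring "local_ring f" "function_field f" "restrict_to_curve f"
    by (rule restrict_to_curve_hom)
  have c: "r - s \<in> carrier (local_ring f)" by (rule vanishing_ideal_subset[OF assms(1)])
  have "restrict_to_curve f r = restrict_to_curve f ((r - s) + s)" by simp
  also have "\<dots> = restrict_to_curve f (r - s) \<oplus>\<^bsub>function_field f\<^esub> restrict_to_curve f s"
    using P.hom_add[OF c assms(2)] by (simp add: local_ring_simps)
  also have "restrict_to_curve f (r - s) = \<zero>\<^bsub>function_field f\<^esub>"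
    using restrict_to_curve_zero_iff[OF c] assms(1) by simp
  finally show ?thesis using assms(2) by simp
qed

lemma function_field_carrier:
  "carrier (function_field f) = restrict_to_curve f ` carrier (local_ring f)"
  by (auto simp: function_field_def FactRing_def A_RCOSETS_def' restrict_to_curve_def)

end

text \<open>A nonzero element \<open>m\<close> of minimal degree in the ideal divides a multiple \<open>c * f\<close> of \<open>f\<close> by
  a nonzero constant \<open>c\<close>; as \<open>m\<close> is not constant, \<open>f\<close> divides \<open>m\<close>, so \<open>f\<close> itself has minimal degree.\<close>

lemma irreducible_dvd_of_no_constants:
  fixes f :: plane_curve
  assumes f: "Factorial_Ring.irreducible f" and "degree f > 0" and "P f"
    and diff: "\<And>a b. P a \<Longrightarrow> P b \<Longrightarrow> P (a - b)" and mult: "\<And>a b. P a \<Longrightarrow> P (b * a)"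
    and const: "\<And>r. P [:r:] \<Longrightarrow> r = 0"
    and "P a"
  shows "f dvd a"
proof -
  have f0: "f \<noteq> 0" using f by auto
  define m where "m = arg_min degree (\<lambda>b. P b \<and> b \<noteq> 0)"
  have m: "P m" "m \<noteq> 0" and min: "\<And>b. P b \<Longrightarrow> b \<noteq> 0 \<Longrightarrow> degree m \<le> degree b"
    using arg_min_nat_lemma[of "\<lambda>b. P b \<and> b \<noteq> 0" f degree] f0 \<open>P f\<close> by (auto simp: m_def)
  \<comment> \<open>The coefficients only form a ring, so pseudo-division brings in a factor
    \<open>c\<close>, a power of the leading coefficient of \<open>n\<close>. The remainder
    satisfies \<open>P\<close> and is zero or of smaller degree than \<open>m\<close>, hence
    zero.\<close>
  have reduce: "\<exists>c q. c \<noteq> 0 \<and> [:c:] * b = n * q"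
    if "P b" "P n" "n \<noteq> 0" "degree n \<le> degree m" for b n
  proof -
    obtain q r where qr: "pseudo_divmod b n = (q, r)" by (cases "pseudo_divmod b n")
    define c where "c = coeff n (degree n) ^ (Suc (degree b) - degree n)"
    have e: "smult c b = n * q + r" and d: "r = 0 \<or> degree r < degree n"
      using pseudo_divmod[OF that(3) qr] by (auto simp: c_def)
    have "r = [:c:] * b - q * n" using e by (simp add: algebra_simps)
    then have "P r" using diff mult that by metis
    then have "r = 0" using d min[of r] that(4) by linarith
    moreover have "c \<noteq> 0" using that(3) by (simp add: c_def)
    ultimately show ?thesis using e by auto
  qed
  have prime: "f dvd b" if "f dvd [:c:] * b" "c \<noteq> 0" for b c
  proof -
    have "\<not> f dvd [:c:]"
    proof
      assume "f dvd [:c:]"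
      then have "degree f \<le> degree [:c:]" using \<open>c \<noteq> 0\<close> by (intro dvd_imp_degree_le) auto
      then show False using \<open>degree f > 0\<close> by simp
    qed
    then show ?thesis using that(1) irreducible_dvd_mult_iff[OF f] by blast
  qed
  obtain c q where cq: "c \<noteq> 0" "[:c:] * f = m * q"
    using reduce[OF \<open>P f\<close> m] by auto
  have "degree m > 0"
  proof (rule ccontr)
    assume "\<not> degree m > 0"
    then obtain r where r: "m = [:r:]" using degree_eq_zeroE by auto
    then show False using const[of r] m by simp
  qed
  \<comment> \<open>Otherwise the prime \<open>f\<close> divides \<open>q\<close>, and comparing
    degrees in \<open>[:c:] * f = m * q\<close> makes \<open>m\<close> constant in the outer
    variable.\<close>
  have "f dvd m"
  proof (rule ccontr)
    assume "\<not> f dvd m"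
    moreover have "f dvd m * q" using cq(2) by (metis dvd_triv_right)
    ultimately have "f dvd q" using irreducible_dvd_mult_iff[OF f] by blast
    moreover have "q \<noteq> 0" using cq f0 by auto
    ultimately have "degree f \<le> degree q" by (rule dvd_imp_degree_le)
    moreover have "degree ([:c:] * f) = degree m + degree q"
      unfolding cq(2) using m(2) \<open>q \<noteq> 0\<close> by (rule degree_mult_eq)
    ultimately show False using \<open>degree m > 0\<close> cq(1) by simp
  qed
  then have "degree f \<le> degree m" using m(2) by (rule dvd_imp_degree_le)
  then obtain c q where "c \<noteq> 0" "[:c:] * a = f * q"
    using reduce[OF \<open>P a\<close> \<open>P f\<close> f0] by auto
  then show ?thesis using prime[of c a] by (metis dvd_triv_left)
qed

section \<open>Isomorphisms of function fields from substitutions\<close>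

text \<open>By \<open>vanishes_iff\<close> the kernel modulo the vanishing ideal of \<open>g\<close>
  is exactly \<open>(f)\<close>: the relation \<open>f = 0\<close> is respected, and admissible
  denominators become units of the local ring of \<open>g\<close>, which is dominance of the
  rational map.\<close>

locale dominant_map = ring_map \<sigma> for \<sigma> :: "rat poly poly \<Rightarrow> rat poly poly fract" +
  fixes f g :: plane_curve
  assumes irr_f: "Factorial_Ring.irreducible f" and irr_g: "Factorial_Ring.irreducible g"
    and in_local_ring: "\<sigma> a \<in> carrier (local_ring g)"
    and vanishes_iff: "\<sigma> a \<in> vanishing_ideal g \<longleftrightarrow> f dvd a"
    and const: "\<sigma> [:[:c:]:] = Fract [:[:c:]:] 1"
begin

text \<open>The extension of \<open>\<sigma>\<close> to the local ring of \<open>f\<close>. The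
  choice is among representations with admissible denominator, since the same fraction also has
  others, such as those expanded by \<open>f\<close>; \<open>pullback_Fract\<close> shows
  independence of the choice.\<close>

definition pullback :: "rat poly poly fract \<Rightarrow> rat poly poly fract" where
  "pullback r = (SOME s. \<exists>a b. r = Fract a b \<and> \<not> f dvd b \<and> s = \<sigma> a / \<sigma> b)"

lemma nonzero: "\<not> f dvd b \<Longrightarrow> \<sigma> b \<noteq> 0"
  using vanishes_iff vanishing_ideal_zero[OF irr_g] by metis

lemma pullback_Fract:
  assumes "\<not> f dvd b"
  shows "pullback (Fract a b) = \<sigma> a / \<sigma> b"
  unfolding pullback_def
proof (rule some_equality)
  fix s assume "\<exists>c d. Fract a b = Fract c d \<and> \<not> f dvd d \<and> s = \<sigma> c / \<sigma> d"
  then obtain c d where cd: "Fract a b = Fract c d" "\<not> f dvd d" "s = \<sigma> c / \<sigma> d" by blast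
  have "b \<noteq> 0" "d \<noteq> 0" using assms cd by auto
  then have "a * d = c * b" using cd by (simp add: eq_fract)
  then have "\<sigma> a * \<sigma> d = \<sigma> c * \<sigma> b" by (metis mult)
  then show "s = \<sigma> a / \<sigma> b"
    using nonzero[OF assms] nonzero[OF cd(2)] cd(3) by (simp add: frac_eq_eq)
qed (use assms in blast)

lemma local_ring_cases:
  assumes "r \<in> carrier (local_ring f)"
  obtains a b where "r = Fract a b" "\<not> f dvd b" "b \<noteq> 0" "pullback r = \<sigma> a / \<sigma> b" "\<sigma> b \<noteq> 0"
    "\<sigma> b \<notin> vanishing_ideal g"
proof -
  obtain a b where "r = Fract a b" "\<not> f dvd b" using assms by (auto simp: local_ring_def)
  then show ?thesis using that[of a b] pullback_Fract nonzero vanishes_iff by auto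
qed

lemma pullback_in:
  assumes "r \<in> carrier (local_ring f)"
  shows "pullback r \<in> carrier (local_ring g)"
proof -
  from assms obtain a b where "pullback r = \<sigma> a / \<sigma> b" "\<sigma> b \<notin> vanishing_ideal g"
    by (rule local_ring_cases)
  then show ?thesis
    using local_ring_inverse[OF irr_g in_local_ring] local_ring_closed(1)[OF irr_g] in_local_ring
    by (simp add: divide_inverse)
qed

lemma
  assumes "r \<in> carrier (local_ring f)" "s \<in> carrier (local_ring f)"
  shows pullback_add: "pullback (r + s) = pullback r + pullback s"
    and pullback_mult: "pullback (r * s) = pullback r * pullback s"
proof -
  obtain a b where r: "r = Fract a b" "\<not> f dvd b" "b \<noteq> 0" "pullback r = \<sigma> a / \<sigma> b" "\<sigma> b \<noteq> 0"
    using assms(1) by (rule local_ring_cases)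
  obtain c d where s: "s = Fract c d" "\<not> f dvd d" "d \<noteq> 0" "pullback s = \<sigma> c / \<sigma> d" "\<sigma> d \<noteq> 0"
    using assms(2) by (rule local_ring_cases)
  have "\<not> f dvd b * d" using r s irreducible_dvd_mult_iff[OF irr_f] by blast
  moreover have "r + s = Fract (a * d + c * b) (b * d)" "r * s = Fract (a * c) (b * d)"
    using r s by auto
  ultimately show "pullback (r + s) = pullback r + pullback s"
    "pullback (r * s) = pullback r * pullback s"
    using r s by (simp_all add: pullback_Fract simps field_simps)
qed

lemma pullback_to_fract: "pullback (to_fract a) = \<sigma> a"
  using pullback_Fract[of 1 a] irr_f
  by (simp add: to_fract_def one Factorial_Ring.irreducible_def)

text \<open>\<open>\<sigma> b\<close> is a unit of the local ring, so
  \<open>\<sigma> a / \<sigma> b\<close> and \<open>\<sigma> a\<close> vanish together.\<close>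

lemma pullback_vanishes_iff:
  assumes "r \<in> carrier (local_ring f)"
  shows "pullback r \<in> vanishing_ideal g \<longleftrightarrow> r \<in> vanishing_ideal f"
proof -
  obtain a b where r: "r = Fract a b" "\<not> f dvd b" "pullback r = \<sigma> a / \<sigma> b" "\<sigma> b \<noteq> 0"
    "\<sigma> b \<notin> vanishing_ideal g"
    using assms by (rule local_ring_cases)
  have "\<sigma> a = \<sigma> b * (\<sigma> a / \<sigma> b)" using r by simp
  then have "\<sigma> a / \<sigma> b \<in> vanishing_ideal g \<longleftrightarrow> \<sigma> a \<in> vanishing_ideal g"
    using vanishing_ideal_mult[OF irr_g _ in_local_ring[of b]]
      vanishing_ideal_mult[OF irr_g _ local_ring_inverse[OF irr_g in_local_ring[of b]]] r(5)
    by (metis divide_inverse mult.commute)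
  then show ?thesis using r vanishes_iff Fract_in_vanishing_ideal_iff[OF irr_f] by simp
qed

text \<open>Membership of the class of \<open>s\<close> in the image of the function field of
  \<open>f\<close>. Equality is asked modulo the vanishing ideal only, since \<open>pullback\<close>
  need not hit \<open>s\<close> itself.\<close>

definition attained :: "rat poly poly fract \<Rightarrow> bool" where
  "attained s \<longleftrightarrow> s \<in> carrier (local_ring g) \<and>
     (\<exists>r \<in> carrier (local_ring f). pullback r - s \<in> vanishing_ideal g)"

lemma attained_image: "attained (\<sigma> a)"
  unfolding attained_def
  using in_local_ring to_fract_in_local_ring[OF irr_f, of a] vanishing_ideal_zero[OF irr_g]
  by (auto simp: pullback_to_fract intro!: bexI[of _ "to_fract a"])

lemma attained_const: "attained (to_fract [:[:c:]:])"
  using attained_image[of "[:[:c:]:]"] by (simp add: const to_fract_def)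

lemma attained_cong:
  assumes "attained s" "t - s \<in> vanishing_ideal g"
  shows "attained t"
proof -
  obtain r where r: "r \<in> carrier (local_ring f)" "pullback r - s \<in> vanishing_ideal g"
    and s: "s \<in> carrier (local_ring g)"
    using assms(1) by (auto simp: attained_def)
  have "t = s + (t - s)" by simp
  then have "t \<in> carrier (local_ring g)"
    using s local_ring_closed(2)[OF irr_g] vanishing_ideal_subset[OF irr_g assms(2)] by metis
  moreover have "pullback r - t = (pullback r - s) - (t - s)" by simp
  then have "pullback r - t \<in> vanishing_ideal g"
    using vanishing_ideal_diff[OF irr_g r(2) assms(2)] by simp
  ultimately show ?thesis using r(1) by (auto simp: attained_def)
qed

lemma
  assumes "attained s" "attained t"
  shows attained_add: "attained (s + t)" and attained_mult: "attained (s * t)"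
proof -
  obtain p q where pq: "p \<in> carrier (local_ring f)" "pullback p - s \<in> vanishing_ideal g"
      "q \<in> carrier (local_ring f)" "pullback q - t \<in> vanishing_ideal g"
    and st: "s \<in> carrier (local_ring g)" "t \<in> carrier (local_ring g)"
    using assms by (auto simp: attained_def)
  have "pullback (p + q) - (s + t) = (pullback p - s) + (pullback q - t)"
    using pq by (simp add: pullback_add)
  then have "pullback (p + q) - (s + t) \<in> vanishing_ideal g"
    using vanishing_ideal_add[OF irr_g pq(2,4)] by metis
  then show "attained (s + t)"
    using local_ring_closed(2)[OF irr_f pq(1,3)] local_ring_closed(2)[OF irr_g st]
    by (auto simp: attained_def)
  have "pullback (p * q) - s * t = pullback q * (pullback p - s) + s * (pullback q - t)"
    using pq by (simp add: pullback_mult algebra_simps)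
  then have "pullback (p * q) - s * t \<in> vanishing_ideal g"
    using vanishing_ideal_add[OF irr_g vanishing_ideal_mult[OF irr_g pq(2) pullback_in[OF pq(3)]]
      vanishing_ideal_mult[OF irr_g pq(4) st(1)]] by metis
  then show "attained (s * t)"
    using local_ring_closed(1)[OF irr_f pq(1,3)] local_ring_closed(1)[OF irr_g st]
    by (auto simp: attained_def)
qed

lemma attained_uminus: "attained s \<Longrightarrow> attained (- s)"
  using attained_mult[OF attained_image[of "- 1"], of s] by (simp add: uminus one)

lemma attained_diff: "attained s \<Longrightarrow> attained t \<Longrightarrow> attained (s - t)"
  using attained_add[OF _ attained_uminus, of s t] by simp

text \<open>With \<open>p = pullback r\<close>, the difference \<open>1/p - 1/s\<close> equals
  \<open>-(p - s)/(p s)\<close>, and \<open>p\<close> and \<open>s\<close> are units because neither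
  vanishes on the curve.\<close>

lemma attained_inverse:
  assumes "attained s" "s \<notin> vanishing_ideal g"
  shows "attained (inverse s)"
proof -
  obtain r where r: "r \<in> carrier (local_ring f)" "pullback r - s \<in> vanishing_ideal g"
    and s: "s \<in> carrier (local_ring g)"
    using assms(1) by (auto simp: attained_def)
  let ?p = "pullback r"
  have p: "?p \<notin> vanishing_ideal g"
  proof
    assume "?p \<in> vanishing_ideal g"
    from vanishing_ideal_diff[OF irr_g this r(2)] show False using assms(2) by simp
  qed
  then have rf: "r \<notin> vanishing_ideal f" using pullback_vanishes_iff[OF r(1)] by simp
  note inv = local_ring_inverse[OF irr_f r(1) rf] local_ring_inverse[OF irr_g s assms(2)]
    local_ring_inverse[OF irr_g pullback_in[OF r(1)] p]
  have nz: "s \<noteq> 0" "?p \<noteq> 0" "r \<noteq> 0"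
    using assms(2) p rf vanishing_ideal_zero[OF irr_f] vanishing_ideal_zero[OF irr_g] by metis+
  have "?p * pullback (inverse r) = pullback (r * inverse r)"
    using r(1) inv(1) by (simp add: pullback_mult)
  also have "\<dots> = 1"
    using nz(3) pullback_to_fract[of 1] by (simp add: one)
  finally have "pullback (inverse r) = inverse ?p"
    using nz(2) by (metis inverse_unique)
  then have "pullback (inverse r) - inverse s = - (inverse ?p * inverse s) * (?p - s)"
    using nz by (simp add: field_simps)
  then have "pullback (inverse r) - inverse s \<in> vanishing_ideal g"
    using vanishing_ideal_mult[OF irr_g r(2) local_ring_uminus[OF irr_g
      local_ring_closed(1)[OF irr_g inv(3,2)]]] by simp
  then show ?thesis using inv by (auto simp: attained_def)
qed

lemma attained_to_fract:
  assumes "attained (to_fract var1)" "attained (to_fract var2)"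
  shows "attained (to_fract a)"
  by (induction a rule: poly_poly_induct) (simp_all add: assms attained_const attained_add attained_mult)

text \<open>First isomorphism theorem: restriction after pullback maps onto the function field of
  \<open>g\<close> with kernel \<open>vanishing_ideal f\<close>. For surjectivity the coordinate
  functions suffice: with the constants they generate all polynomials, and quotients of attained
  elements are attained.\<close>

theorem birational_over_QI:
  assumes "attained (to_fract var1)" "attained (to_fract var2)"
  shows "birational_over_Q f g"
proof -
  interpret Rf: cring "local_ring f" by (rule local_ring_cring[OF irr_f])
  interpret Rg: cring "local_ring g" by (rule local_ring_cring[OF irr_g])
  interpret P: ring_hom_ring "local_ring g" "function_field g" "restrict_to_curve g"
    by (rule restrict_to_curve_hom[OF irr_g])
  define p where "p r = restrict_to_curve g (pullback r)" for r
  have hom: "p \<in> ring_hom (local_ring f) (function_field g)"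
  proof (rule ring_hom_memI)
    fix r s assume rs: "r \<in> carrier (local_ring f)" "s \<in> carrier (local_ring f)"
    show "p r \<in> carrier (function_field g)" using rs pullback_in by (simp add: p_def)
    show "p (r \<otimes>\<^bsub>local_ring f\<^esub> s) = p r \<otimes>\<^bsub>function_field g\<^esub> p s"
      using rs P.hom_mult[OF pullback_in pullback_in, of r s]
      by (simp add: p_def local_ring_simps pullback_mult)
    show "p (r \<oplus>\<^bsub>local_ring f\<^esub> s) = p r \<oplus>\<^bsub>function_field g\<^esub> p s"
      using rs P.hom_add[OF pullback_in pullback_in, of r s]
      by (simp add: p_def local_ring_simps pullback_add)
  next
    show "p \<one>\<^bsub>local_ring f\<^esub> = \<one>\<^bsub>function_field g\<^esub>"
      using P.hom_one pullback_to_fract[of 1] by (simp add: p_def local_ring_simps one)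
  qed
  have "ring_hom_ring (local_ring f) (function_field g) p"
    by (rule ring_hom_ringI2[OF Rf.ring_axioms P.S.ring_axioms hom])
  then interpret H: ring_hom_ring "local_ring f" "function_field g" p .
  have kernel: "a_kernel (local_ring f) (function_field g) p = vanishing_ideal f"
  proof -
    have "p r = \<zero>\<^bsub>function_field g\<^esub> \<longleftrightarrow> r \<in> vanishing_ideal f"
      if "r \<in> carrier (local_ring f)" for r
      unfolding p_def using that
      by (simp only: restrict_to_curve_zero_iff[OF irr_g pullback_in] pullback_vanishes_iff)
    then show ?thesis
      unfolding a_kernel_def' using vanishing_ideal_subset[OF irr_f] by blast
  qed
  have surj: "p ` carrier (local_ring f) = carrier (function_field g)"
  proof
    show "p ` carrier (local_ring f) \<subseteq> carrier (function_field g)" using H.hom_closed by blast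
    show "carrier (function_field g) \<subseteq> p ` carrier (local_ring f)"
    proof
      fix u assume "u \<in> carrier (function_field g)"
      then obtain s where s: "s \<in> carrier (local_ring g)" "u = restrict_to_curve g s"
        by (auto simp: function_field_carrier[OF irr_g])
      then obtain a b where ab: "s = Fract a b" "\<not> g dvd b" by (auto simp: local_ring_def)
      have "attained (to_fract a * inverse (to_fract b))"
        using ab(2) attained_to_fract[OF assms]
        by (intro attained_mult attained_inverse)
           (simp_all add: to_fract_in_vanishing_ideal_iff[OF irr_g])
      moreover have "s = to_fract a * inverse (to_fract b)"
        using ab by (simp add: to_fract_def)
      ultimately obtain r where "r \<in> carrier (local_ring f)" "pullback r - s \<in> vanishing_ideal g"
        by (auto simp: attained_def)
      then show "u \<in> p ` carrier (local_ring f)"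
        using restrict_to_curve_cong[OF irr_g] s by (intro image_eqI[of _ _ r]) (auto simp: p_def)
    qed
  qed
  \<comment> \<open>\<open>p\<close> is constant on each coset \<open>X\<close> of its kernel, so
    \<open>the_elem\<close> reads off the single value.\<close>
  define h where "h X = the_elem (p ` X)" for X
  have iso: "h \<in> ring_iso (function_field f) (function_field g)"
    using H.FactRing_iso_set[OF surj, unfolded kernel] by (simp add: function_field_def h_def[abs_def])
  have "h (const_on_curve f c) = const_on_curve g c" for c
  proof -
    have "Fract [:[:c:]:] 1 \<in> carrier (local_ring f)" by (rule const_in_local_ring[OF irr_f])
    from H.the_elem_simp[OF this] show ?thesis
      using pullback_to_fract[of "[:[:c:]:]"]
      by (simp add: const_on_curve_def restrict_to_curve_def[of f] kernel p_def h_def const to_fract_def)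
  qed
  then show ?thesis unfolding birational_over_Q_def using irr_f irr_g iso by blast
qed

end

section \<open>Irreducibility\<close>

lemma ring_map_of_rat: "ring_map (of_rat :: rat \<Rightarrow> 'a::field_char_0)"
  by unfold_locales (simp_all add: of_rat_add of_rat_mult)

lemma ring_map_to_fract_const: "ring_map (\<lambda>c. to_fract [:[:c:]:])"
  by unfold_locales (simp_all flip: to_fract_add to_fract_mult one_pCons)

lemma ring_map_to_fract: "ring_map to_fract"
  by unfold_locales simp_all

text \<open>The factors of a monic polynomial have unit leading coefficients, so \<open>h\<close>
  preserves their degrees. A factor that becomes a unit is therefore a constant, and equal to its
  unit leading coefficient.\<close>

lemma irreducible_monic_poly_hom:
  fixes f :: "'a::idom poly" and h :: "'a \<Rightarrow> 'b::field"
  assumes "ring_map h" and monic: "lead_coeff f = 1"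
    and irr: "Factorial_Ring.irreducible (map_poly h f)"
  shows "Factorial_Ring.irreducible f"
proof -
  interpret h: ring_map h by fact
  interpret m: ring_map "map_poly h" by (rule h.ring_map_map_poly)
  have unit: "a dvd 1" if "f = a * b" "map_poly h a dvd 1" for a b
  proof -
    have l: "lead_coeff a * lead_coeff b = 1" using monic that(1) by (simp add: lead_coeff_mult)
    then have "h (lead_coeff a) * h (lead_coeff b) = 1" by (metis h.mult h.one)
    then have "coeff (map_poly h a) (degree a) \<noteq> 0" by (auto simp: coeff_map_poly h.zero)
    then have "degree a \<le> degree (map_poly h a)" by (rule le_degree)
    moreover have "degree (map_poly h a) = 0"
    proof -
      have "map_poly h a \<noteq> 0" using \<open>coeff (map_poly h a) (degree a) \<noteq> 0\<close> by auto
      from is_unit_iff_degree[OF this] that(2) show ?thesis by simp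
    qed
    ultimately obtain c where "a = [:c:]" using degree_eq_zeroE by auto
    then show ?thesis using l by (auto simp: is_unit_const_poly_iff intro: dvdI[of 1 c "lead_coeff b"])
  qed
  show ?thesis
  proof (rule Factorial_Ring.irreducibleI)
    show "f \<noteq> 0" using monic by auto
    show "\<not> f dvd 1"
    proof
      assume "f dvd 1"
      then obtain b where "1 = f * b" by (rule dvdE)
      then have "1 = map_poly h f * map_poly h b" by (metis m.mult m.one)
      then show False using irr by (metis dvd_triv_left Factorial_Ring.irreducible_not_unit)
    qed
    fix a b assume ab: "f = a * b"
    then have "map_poly h a dvd 1 \<or> map_poly h b dvd 1"
      using irr by (metis m.mult irreducibleD)
    then show "a dvd 1 \<or> b dvd 1" using unit[OF ab] unit[of b a] ab by (auto simp: mult.commute)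
  qed
qed

lemma reducible_poly_factor:
  fixes p :: "'a::field poly"
  assumes "\<not> Factorial_Ring.irreducible p" "degree p = n" "n > 0"
  obtains c d where "p = c * d" "lead_coeff c = 1" "degree c > 0" "2 * degree c \<le> n"
proof -
  have "p \<noteq> 0" using assms by auto
  have "\<not> p dvd 1" using assms \<open>p \<noteq> 0\<close> by (auto simp: is_unit_iff_degree)
  then obtain a b where ab: "p = a * b" "\<not> a dvd 1" "\<not> b dvd 1"
    using assms \<open>p \<noteq> 0\<close> unfolding Factorial_Ring.irreducible_def by auto
  note result = that
  have main: thesis if "p = a * b" "\<not> a dvd 1" "degree a \<le> degree b" for a b
  proof (rule result)
    have nz: "a \<noteq> 0" "b \<noteq> 0" using that \<open>p \<noteq> 0\<close> by auto
    show "p = smult (inverse (lead_coeff a)) a * smult (lead_coeff a) b" using that nz by simp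
    show "lead_coeff (smult (inverse (lead_coeff a)) a) = 1" using nz by simp
    show "degree (smult (inverse (lead_coeff a)) a) > 0"
      using that nz by (simp add: is_unit_iff_degree)
    show "2 * degree (smult (inverse (lead_coeff a)) a) \<le> n"
      unfolding assms(2)[symmetric] using that nz by (simp add: degree_mult_eq)
  qed
  show thesis using main[of a b] main[of b a] ab by (metis mult.commute nat_le_linear)
qed

lemma degree_one_monic:
  assumes "degree p = 1" "lead_coeff p = (1::'a::comm_ring_1)"
  obtains a where "p = [:a, 1:]"
proof
  show "p = [:coeff p 0, 1:]"
    using assms by (intro poly_eqI) (auto simp: coeff_pCons coeff_eq_0 split: nat.splits)
qed

lemma degree_two_coeffs:
  assumes "degree p \<le> 2"
  shows "p = [:coeff p 0, coeff p 1, coeff p 2:]"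
  using assms by (intro poly_eqI) (auto simp: coeff_pCons coeff_eq_0 numeral_2_eq_2 split: nat.splits)

section \<open>Irreducibility of the quartic \<open>y^4 - 32 y - 24\<close>\<close>

lemma rat_coprime_quotient:
  fixes r :: rat
  obtains m n where "r = of_int m / of_int n" "n > 0" "coprime m n"
proof -
  obtain m n where "quotient_of r = (m, n)" by (cases "quotient_of r")
  then show thesis
    using that quotient_of_div quotient_of_denom_pos quotient_of_coprime by blast
qed

text \<open>For \<open>r = m / n\<close> in lowest terms \<open>m\<close> is even, and after
  division by 8 the equation forces \<open>n\<close> to be even too.\<close>

lemma quartic_no_root: "(r::rat) ^ 4 - 32 * r - 24 \<noteq> 0"
proof
  assume *: "r ^ 4 - 32 * r - 24 = 0"
  obtain m n where mn: "r = of_int m / of_int n" "n > 0" "coprime m n"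
    by (rule rat_coprime_quotient)
  have "(of_int (m^4) :: rat) = of_int (32 * m * n^3 + 24 * n^4)"
    using * mn(2) unfolding mn(1) by (simp add: field_simps power4_eq_xxxx power3_eq_cube)
  then have e: "m ^ 4 = 32 * m * n ^ 3 + 24 * n ^ 4" by linarith
  then have "even (m ^ 4)" by simp
  then have "even m" by simp
  then obtain k where k: "m = 2 * k" by (rule evenE)
  have "2 * k ^ 4 = 8 * k * n ^ 3 + 3 * n ^ 4" using e k by (simp add: power_mult_distrib)
  then have "3 * n ^ 4 = 2 * (k ^ 4 - 4 * k * n ^ 3)" by simp
  then have "even (3 * n ^ 4)" by (metis dvd_triv_left)
  then have "even n" by simp
  then show False using \<open>even m\<close> mn(3) by (meson coprime_common_divisor odd_one)
qed

text \<open>This is the resolvent cubic \<open>T^3 + 96 T - 1024\<close> of the quartic at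
  \<open>T = a^2\<close>. For \<open>a = m / n\<close> in lowest terms, three halvings show that 8
  divides \<open>m\<close>; the equation then makes \<open>n\<close> even as well.\<close>

lemma resolvent_no_root: "(a::rat) ^ 6 + 96 * a ^ 2 - 1024 \<noteq> 0"
proof
  assume *: "a ^ 6 + 96 * a ^ 2 - 1024 = 0"
  obtain m n where mn: "a = of_int m / of_int n" "n > 0" "coprime m n"
    by (rule rat_coprime_quotient)
  have "(of_int (m^6 + 96 * m^2 * n^4) :: rat) = of_int (1024 * n^6)"
    using * mn(2) unfolding mn(1) by (simp add: field_simps eval_nat_numeral)
  then have e: "m ^ 6 + 96 * m ^ 2 * n ^ 4 = 1024 * n ^ 6" by linarith
  then have "even (m ^ 6 + 96 * m ^ 2 * n ^ 4)" by simp
  then have "even m" by simp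
  then obtain k where k: "m = 2 * k" by (rule evenE)
  have k': "k ^ 6 + 6 * k ^ 2 * n ^ 4 = 16 * n ^ 6" using e k by (simp add: power_mult_distrib)
  then have "even (k ^ 6 + 6 * k ^ 2 * n ^ 4)" by simp
  then have "even k" by simp
  then obtain j where j: "k = 2 * j" by (rule evenE)
  have j': "8 * j ^ 6 + 3 * j ^ 2 * n ^ 4 = 2 * n ^ 6" using k' j by (simp add: power_mult_distrib)
  then have "3 * j ^ 2 * n ^ 4 = 2 * (n ^ 6 - 4 * j ^ 6)" by simp
  then have "even (3 * j ^ 2 * n ^ 4)" by (metis dvd_triv_left)
  then have "even j \<or> even n" by simp
  moreover have "odd n" using \<open>even m\<close> mn(3) by (meson coprime_common_divisor odd_one)
  ultimately obtain i where i: "j = 2 * i" by (auto elim: evenE)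
  have "256 * i ^ 6 + 6 * i ^ 2 * n ^ 4 = n ^ 6" using j' i by (simp add: power_mult_distrib)
  then have "n ^ 6 = 2 * (128 * i ^ 6 + 3 * i ^ 2 * n ^ 4)" by simp
  then have "even (n ^ 6)" by (metis dvd_triv_left)
  then show False using \<open>odd n\<close> by simp
qed

text \<open>Linear factors are excluded by \<open>quartic_no_root\<close>. Two quadratic factors
  would be \<open>Y^2 + a Y + b\<close> and \<open>Y^2 - a Y + p\<close>, with \<open>a^2\<close> a
  root of the resolvent cubic.\<close>

lemma irreducible_quartic: "Factorial_Ring.irreducible [:-24, -32, 0, 0, 1::rat:]"
proof (rule ccontr)
  assume "\<not> Factorial_Ring.irreducible [:-24, -32, 0, 0, 1::rat:]"
  moreover have "degree [:-24, -32, 0, 0, 1::rat:] = 4" "(4::nat) > 0" by simp_all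
  ultimately obtain c d where cd: "[:-24, -32, 0, 0, 1::rat:] = c * d" "lead_coeff c = 1"
      "degree c > 0" "2 * degree c \<le> 4"
    by (rule reducible_poly_factor)
  then consider "degree c = 1" | "degree c = 2" by linarith
  then show False
  proof cases
    case 1
    then obtain a where "c = [:a, 1:]" using cd(2) by (rule degree_one_monic)
    then have "poly [:-24, -32, 0, 0, 1::rat:] (- a) = 0" unfolding cd(1) by simp
    then show False using quartic_no_root[of "- a"] by (simp add: algebra_simps eval_nat_numeral)
  next
    case 2
    have "d \<noteq> 0" "c \<noteq> 0" using cd by auto
    then have "degree c + degree d = 4" using degree_mult_eq[of c d] cd(1)[symmetric] by simp
    then have "degree d \<le> 2" using 2 by simp
    then obtain p q s where d: "d = [:p, q, s:]" using degree_two_coeffs by blast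
    obtain b a where c: "c = [:b, a, 1:]"
      using degree_two_coeffs[of c] 2 cd(2) by force
    have e: "b * p = -24" "b * q + a * p = -32" "b * s + a * q + p = 0" "a * s + q = 0" "s = 1"
      using cd(1) unfolding c d by (auto simp: algebra_simps)
    have q: "q = - a" using e by simp
    have 1: "p + b = a\<^sup>2" using e q by (simp add: power2_eq_square)
    have 2: "a * (p - b) = -32" using e q by (simp add: algebra_simps)
    \<comment> \<open>Eliminates \<open>b\<close> and \<open>p\<close> from their sum, their product
      and \<open>a * (p - b)\<close>.\<close>
    have "a\<^sup>2 * ((p + b)\<^sup>2 - 4 * (b * p)) = (a * (p - b))\<^sup>2"
      by (simp add: power2_eq_square algebra_simps)
    then have "a\<^sup>2 * ((a\<^sup>2)\<^sup>2 + 96) = 1024" unfolding 1 2 e(1) by simp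
    then show False using resolvent_no_root[of a] by (simp add: algebra_simps eval_nat_numeral)
  qed
qed

lemma irreducible_square_plus_pos:
  assumes "(c::rat) > 0"
  shows "Factorial_Ring.irreducible [:c, 0, 1:]"
proof (rule ccontr)
  assume "\<not> Factorial_Ring.irreducible [:c, 0, 1:]"
  moreover have "degree [:c, 0, 1:] = 2" "(2::nat) > 0" by simp_all
  ultimately obtain p q where pq: "[:c, 0, 1:] = p * q" "lead_coeff p = 1" "degree p > 0"
      "2 * degree p \<le> 2"
    by (rule reducible_poly_factor)
  then have "degree p = 1" by linarith
  then obtain a where "p = [:a, 1:]" using pq(2) by (rule degree_one_monic)
  then have "poly [:c, 0, 1:] (- a) = 0" unfolding pq(1) by simp
  then have "c + a\<^sup>2 = 0" by (simp add: power2_eq_square)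
  then show False using assms zero_le_power2[of a] by linarith
qed

lemma K3_coeffs:
  "K3 = [:[:-24,0,96,0,0,64,0,0,8:], [:-32,0,0,-128,0,0,-32:], [:0,48,0,0,40:], [:0,0,-16:], 1:]"
  by (simp add: K3_def Let_def var1_def var2_def power_numeral_even power_numeral_odd numeral_poly)

lemma Ks_coeffs: "Ks = [:[:0,-2,-8,4,-8,-2:], 0, 1:]"
  by (simp add: Ks_def Let_def var1_def var2_def power_numeral_even power_numeral_odd numeral_poly,
    subst one_pCons, simp, subst one_pCons, simp)

text \<open>Specialisation at \<open>x = 0\<close> gives the irreducible quartic above.\<close>

lemma irreducible_K3: "Factorial_Ring.irreducible K3"
proof (rule irreducible_monic_poly_hom)
  show "ring_map (\<lambda>c. poly c 0 :: rat)" by unfold_locales simp_all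
  show "lead_coeff K3 = 1" by (simp add: K3_coeffs)
  show "Factorial_Ring.irreducible (map_poly (\<lambda>c. poly c 0 :: rat) K3)"
    using irreducible_quartic by (simp add: K3_coeffs map_poly_pCons)
qed

text \<open>At \<open>z = -5\<close> the right-hand side of the curve equation is -560, and
  \<open>w^2 + 560\<close> is irreducible over the rationals.\<close>

lemma irreducible_Ks: "Factorial_Ring.irreducible Ks"
proof (rule irreducible_monic_poly_hom)
  show "ring_map (\<lambda>c. poly c (-5) :: rat)" by unfold_locales simp_all
  show "lead_coeff Ks = 1" by (simp add: Ks_coeffs)
  show "Factorial_Ring.irreducible (map_poly (\<lambda>c. poly c (-5) :: rat) Ks)"
    using irreducible_square_plus_pos[of 560] by (simp add: Ks_coeffs map_poly_pCons)
qed

section \<open>The two curves\<close>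

text \<open>The function \<open>x\<close> on \<open>Ks\<close> and its hyperelliptic conjugate are the roots of \<open>cPhi\<close>, that is of
  \<open>C(z) X\<^sup>2 - 2 A(z) X + N(z)\<close>; \<open>cQ\<close> is the cofactor of \<open>cPhi\<close> in
  \<open>(z + 3)\<^sup>4 K3(x, T(x,z) / (z + 3))\<close>.\<close>

definition cA :: "'a::comm_ring_1 \<Rightarrow> 'a" where
  "cA z = 3 - 18 * z^2 - 8 * z^3 - z^4"

definition cB :: "'a::comm_ring_1 \<Rightarrow> 'a" where
  "cB z = 6 + 2 * z"

definition cC :: "'a::comm_ring_1 \<Rightarrow> 'a" where
  "cC z = z^4 + 4 * z^3 - 2 * z^2 - 12 * z + 1"

definition cN :: "'a::comm_ring_1 \<Rightarrow> 'a" where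
  "cN z = z^4 + 4 * z^3 + 6 * z^2 + 36 * z + 9"

definition cH :: "'a::comm_ring_1 \<Rightarrow> 'a" where
  "cH z = 2 * z * (z^4 + 4 * z^3 - 2 * z^2 + 4 * z + 1)"

definition cT :: "'a::comm_ring_1 \<Rightarrow> 'a \<Rightarrow> 'a" where
  "cT x z = (5 - z^2) * x^2 - 2 * z * (z + 5) * x - (z + 1) * (z + 3)"

definition cPhi :: "'a::comm_ring_1 \<Rightarrow> 'a \<Rightarrow> 'a" where
  "cPhi x z = cC z * x^2 - 2 * cA z * x + cN z"

definition cQ :: "'a::comm_ring_1 \<Rightarrow> 'a \<Rightarrow> 'a" where
  "cQ x z = (81 + 108 * z + 54 * z^2 + 12 * z^3 + z^4)
    + (486 + 648 * z + 324 * z^2 + 72 * z^3 + 6 * z^4) * x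
    + (783 + 1332 * z + 762 * z^2 + 180 * z^3 + 15 * z^4) * x^2
    + (180 + 1392 * z + 984 * z^2 + 240 * z^3 + 20 * z^4) * x^3
    + (- 177 + 1012 * z + 730 * z^2 + 180 * z^3 + 15 * z^4) * x^4
    + (- 282 + 136 * z + 260 * z^2 + 72 * z^3 + 6 * z^4) * x^5
    + (- 47 - 20 * z + 22 * z^2 + 12 * z^3 + z^4) * x^6"

definition cF :: "'a::comm_ring_1 \<Rightarrow> 'a \<Rightarrow> 'a" where
  "cF x y = 8*x^8 - 32*x^6*y + 40*x^4*y^2 + 64*x^5 - 16*x^2*y^3 - 128*x^3*y + y^4
       + 48*x*y^2 + 96*x^2 - 32*y - 24"

definition cP1 :: "'a::comm_ring_1 \<Rightarrow> 'a \<Rightarrow> 'a" where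
  "cP1 x y = y^2 - 6 * x^2 * y - 2 * y + 4 * x^4 + 8 * x"

definition cP2 :: "'a::comm_ring_1 \<Rightarrow> 'a \<Rightarrow> 'a" where
  "cP2 x y = 3 * x^2 * y + 2 * x * y + y - 2 * x^4 - 2 * x^3 - 6 * x - 2"

text \<open>A quarter of the discriminant of \<open>cPhi\<close> in \<open>x\<close> is thus a
  square times the right-hand side of \<open>Ks\<close>; with \<open>w^2 = H\<close> the roots are
  \<open>(A + B w) / C\<close> and \<open>(A - B w) / C\<close>.\<close>

lemma discriminant:
  fixes z :: "'a::idom"
  shows "(cA z)^2 - (cB z)^2 * cH z = cN z * cC z"
  unfolding cA_def cB_def cH_def cN_def cC_def by Groebner_Basis.algebra

text \<open>After distributing \<open>(z + 3)^2\<close>, \<open>y\<close> occurs only in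
  \<open>y * (z + 3)\<close>; replacing this by \<open>cT x z\<close> leaves a polynomial identity
  in \<open>x\<close> and \<open>z\<close>. Where \<open>cPhi\<close> vanishes and
  \<open>z + 3\<close> and \<open>P2\<close> do not, it yields
  \<open>z = - (P1 + P2) / P2\<close>.\<close>

lemma cP_identity:
  fixes x y z :: "'a::idom"
  assumes "y * (z + 3) = cT x z"
  shows "(z + 3)^2 * (cP1 x y + (z + 1) * cP2 x y) = - 2 * x^2 * cPhi x z"
proof -
  have "(z + 3)^2 * (cP1 x y + (z + 1) * cP2 x y) =
    (y * (z + 3))^2 - (6 * x^2 + 2) * (z + 3) * (y * (z + 3)) + (4 * x^4 + 8 * x) * (z + 3)^2
    + (z + 1) * ((3 * x^2 + 2 * x + 1) * (z + 3) * (y * (z + 3))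
      - (2 * x^4 + 2 * x^3 + 6 * x + 2) * (z + 3)^2)"
    unfolding cP1_def cP2_def by Groebner_Basis.algebra
  also have "\<dots> = - 2 * x^2 * cPhi x z"
    unfolding assms unfolding cT_def cPhi_def cC_def cA_def cN_def by Groebner_Basis.algebra
  finally show ?thesis .
qed

text \<open>The same substitution, with a fourth power because \<open>K3\<close> has degree four in
  \<open>y\<close>. Where \<open>cPhi\<close> vanishes and \<open>z + 3\<close> does not,
  \<open>(x, y)\<close> lies on \<open>K3\<close>.\<close>

lemma cF_identity:
  fixes x y z :: "'a::idom"
  assumes "y * (z + 3) = cT x z"
  shows "(z + 3)^4 * cF x y = cQ x z * cPhi x z"
proof -
  have "(z + 3)^4 * cF x y =
    (8*x^8 + 64*x^5 + 96*x^2 - 24) * (z + 3)^4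
    - (32*x^6 + 128*x^3 + 32) * (z + 3)^3 * (y * (z + 3))
    + (40*x^4 + 48*x) * (z + 3)^2 * (y * (z + 3))^2
    - 16*x^2 * (z + 3) * (y * (z + 3))^3 + (y * (z + 3))^4"
    unfolding cF_def by Groebner_Basis.algebra
  also have "\<dots> = cQ x z * cPhi x z"
    unfolding assms unfolding cT_def cPhi_def cC_def cA_def cN_def cQ_def by Groebner_Basis.algebra
  finally show ?thesis .
qed


lemma (in ring_map) map_coefficients:
  "h (cA z) = cA (h z)" "h (cB z) = cB (h z)" "h (cC z) = cC (h z)" "h (cH z) = cH (h z)"
  by (simp_all add: cA_def cB_def cC_def cH_def simps)

lemma
  assumes h: "ring_map h"
  shows eval2_K3: "eval2 h x y K3 = cF x y"
    and eval2_Ks: "eval2 h x y Ks = y^2 - cH x"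
    and eval2_cP1: "eval2 h x y (cP1 var1 var2) = cP1 x y"
    and eval2_cP2: "eval2 h x y (cP2 var1 var2) = cP2 x y"
proof -
  interpret e: ring_map "eval2 h x y" by (rule ring_map_eval2[OF h])
  show "eval2 h x y K3 = cF x y" "eval2 h x y Ks = y^2 - cH x"
    "eval2 h x y (cP1 var1 var2) = cP1 x y" "eval2 h x y (cP2 var1 var2) = cP2 x y"
    by (simp_all add: K3_def Ks_def Let_def cF_def cH_def cP1_def cP2_def e.simps
      eval2_var1[OF h] eval2_var2[OF h])
qed

text \<open>Multiples of \<open>Ks\<close> vanish at its points, so one point certifies
  non-divisibility. Real coordinates admit points over the roots of \<open>cC\<close>, none of which
  is rational.\<close>

lemma not_Ks_dvd:
  fixes u v :: real
  assumes "v^2 = cH u" "eval2 of_rat u v p \<noteq> 0"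
  shows "\<not> Ks dvd p"
proof
  interpret e: ring_map "eval2 of_rat u v" by (intro ring_map_eval2 ring_map_of_rat)
  assume "Ks dvd p"
  then obtain q where "p = Ks * q" by (rule dvdE)
  then show False using assms by (simp add: e.mult eval2_Ks[OF ring_map_of_rat])
qed

section \<open>The rational functions \<open>x\<close> and \<open>y\<close> on
  \<open>Ks\<close>\<close>

abbreviation fz :: "rat poly poly fract" where "fz \<equiv> to_fract var1"
abbreviation fw :: "rat poly poly fract" where "fw \<equiv> to_fract var2"

definition fx :: "rat poly poly fract" where
  "fx = (cA fz + cB fz * fw) / cC fz"

definition fy :: "rat poly poly fract" where
  "fy = cT fx fz / (fz + 3)"

lemma not_Ks_dvd_denominators:
  "\<not> Ks dvd cC var1" "\<not> Ks dvd cB var1" "\<not> Ks dvd var1 + 3"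
proof -
  interpret e: ring_map "eval2 of_rat (0::real) 0" by (intro ring_map_eval2 ring_map_of_rat)
  note [simp] = e.map_coefficients e.simps eval2_var1[OF ring_map_of_rat]
  show "\<not> Ks dvd cC var1" "\<not> Ks dvd cB var1" "\<not> Ks dvd var1 + 3"
    \<comment> \<open>The origin lies on \<open>Ks\<close>, and there the three polynomials take the
      values 1, 6 and 3.\<close>
    by (rule not_Ks_dvd[of 0 0]; simp add: cB_def cC_def cH_def)+
qed

interpretation tf: ring_map to_fract by (rule ring_map_to_fract)

lemma denominators_nonvanishing:
  "cC fz \<notin> vanishing_ideal Ks" "cB fz \<notin> vanishing_ideal Ks" "fz + 3 \<notin> vanishing_ideal Ks"
  using not_Ks_dvd_denominators
  by (simp_all flip: to_fract_in_vanishing_ideal_iff[OF irreducible_Ks]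
    add: tf.map_coefficients tf.simps)

lemma denominators_nonzero: "cC fz \<noteq> 0" "cB fz \<noteq> 0" "fz + 3 \<noteq> 0"
  using denominators_nonvanishing vanishing_ideal_zero[OF irreducible_Ks] by metis+

lemma fy_mult: "fy * (fz + 3) = cT fx fz"
  using denominators_nonzero by (simp add: fy_def)

lemma cC_fx: "cC fz * fx = cA fz + cB fz * fw"
  using denominators_nonzero by (simp add: fx_def)

abbreviation O_Ks :: "rat poly poly fract set" where
  "O_Ks \<equiv> carrier (local_ring Ks)"

lemma O_Ks_numeral: "numeral n \<in> O_Ks"
  using to_fract_in_local_ring[OF irreducible_Ks, of "numeral n"] by (simp add: tf.numeral)

lemma O_Ks_power: "r \<in> O_Ks \<Longrightarrow> r ^ n \<in> O_Ks"
  by (induction n) (simp_all add: local_ring_closed[OF irreducible_Ks])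

lemma O_Ks_divide: "r \<in> O_Ks \<Longrightarrow> s \<in> O_Ks \<Longrightarrow> s \<notin> vanishing_ideal Ks \<Longrightarrow> r / s \<in> O_Ks"
  by (simp add: divide_inverse local_ring_closed[OF irreducible_Ks] local_ring_inverse[OF irreducible_Ks])

lemmas O_Ks_intros = local_ring_closed[OF irreducible_Ks] local_ring_uminus[OF irreducible_Ks]
  local_ring_diff[OF irreducible_Ks] O_Ks_numeral O_Ks_power to_fract_in_local_ring[OF irreducible_Ks]

lemma fx_in: "fx \<in> O_Ks"
  unfolding fx_def
proof (rule O_Ks_divide)
  show "cA fz + cB fz * fw \<in> O_Ks" "cC fz \<in> O_Ks"
    unfolding cA_def cB_def cC_def by (intro O_Ks_intros)+
qed (rule denominators_nonvanishing)

lemma fy_in: "fy \<in> O_Ks"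
  unfolding fy_def
proof (rule O_Ks_divide)
  show "cT fx fz \<in> O_Ks" "fz + 3 \<in> O_Ks"
    unfolding cT_def by (intro O_Ks_intros fx_in)+
qed (rule denominators_nonvanishing)

text \<open>Completing the square: \<open>C Phi = (C x - A)^2 - B^2 H = B^2 (w^2 - H)\<close>. As
  \<open>z\<close> and \<open>w\<close> are independent in the fraction field, \<open>cPhi\<close>
  vanishes only modulo the ideal.\<close>

lemma cPhi_vanishes: "cPhi fx fz \<in> vanishing_ideal Ks"
proof -
  have "cC fz * cPhi fx fz = (cC fz * fx)^2 - 2 * cA fz * (cC fz * fx) + cN fz * cC fz"
    by (simp add: cPhi_def algebra_simps power2_eq_square)
  also have "\<dots> = (cB fz)^2 * (fw^2 - cH fz)"
    unfolding cC_fx discriminant[symmetric] by (simp add: algebra_simps power2_eq_square)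
  also have "fw^2 - cH fz = to_fract Ks"
    by (simp add: Ks_def Let_def cH_def tf.simps)
  finally have "cPhi fx fz = ((cB fz)^2 / cC fz) * to_fract Ks"
    using denominators_nonzero by (simp add: field_simps)
  moreover have "(cB fz)^2 / cC fz \<in> O_Ks"
    by (rule O_Ks_divide[OF _ _ denominators_nonvanishing(1)])
      (unfold cB_def cC_def, (intro O_Ks_intros)+)
  moreover have "to_fract Ks \<in> vanishing_ideal Ks"
    by (simp add: to_fract_in_vanishing_ideal_iff[OF irreducible_Ks])
  ultimately show ?thesis
    using vanishing_ideal_mult[OF irreducible_Ks] by metis
qed

text \<open>\<open>z + 3\<close> is a unit of the local ring, so its powers can be
  cancelled.\<close>

lemma multiple_of_cPhi_vanishes:
  assumes "(fz + 3)^n * r = s * cPhi fx fz" "s \<in> O_Ks"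
  shows "r \<in> vanishing_ideal Ks"
proof -
  have "inverse (fz + 3) ^ n * s \<in> O_Ks"
    by (intro O_Ks_intros assms(2) local_ring_inverse[OF irreducible_Ks] denominators_nonvanishing)
  moreover have "r = inverse (fz + 3) ^ n * s * cPhi fx fz"
    using denominators_nonzero assms(1) by (simp add: field_simps)
  ultimately show ?thesis using vanishing_ideal_mult[OF irreducible_Ks cPhi_vanishes] by simp
qed

section \<open>The substitution homomorphism and its kernel modulo the vanishing ideal\<close>

abbreviation pull :: "rat poly poly \<Rightarrow> rat poly poly fract" where
  "pull \<equiv> eval2 (\<lambda>c. to_fract [:[:c:]:]) fx fy"

interpretation pl: ring_map pull
  by (intro ring_map_eval2 ring_map_to_fract_const)

lemma pull_in: "pull p \<in> O_Ks"
  by (induction p rule: poly_poly_induct)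
    (auto simp: pl.simps eval2_const[OF ring_map_to_fract_const] eval2_var1[OF ring_map_to_fract_const]
      eval2_var2[OF ring_map_to_fract_const] intro: O_Ks_intros fx_in fy_in)

lemma pull_K3: "pull K3 \<in> vanishing_ideal Ks"
  unfolding eval2_K3[OF ring_map_to_fract_const]
proof (rule multiple_of_cPhi_vanishes[OF cF_identity[OF fy_mult]])
  show "cQ fx fz \<in> O_Ks" unfolding cQ_def by (intro O_Ks_intros fx_in)
qed

text \<open>A real point of the curve at which \<open>x\<close> has a pole.\<close>

lemma pole_exists:
  obtains u v :: real where "v^2 = cH u" "cC u = 0" "cA u + cB u * v \<noteq> 0"
proof -
  \<comment> \<open>\<open>cC\<close> changes sign on the interval: it is 1 at 0 and -8 at
    1.\<close>
  have "\<exists>u>0. u < 1 \<and> poly [:1, -12, -2, 4, 1::real:] u = 0"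
    by (rule poly_IVT_neg) simp_all
  then obtain u :: real where u: "u > 0" "poly [:1, -12, -2, 4, 1:] u = 0" by blast
  have C: "cC u = 0" using u(2) by (simp add: cC_def algebra_simps eval_nat_numeral)
  have B: "cB u > 0" using u(1) by (simp add: cB_def)
  have e: "(cA u)^2 = (cB u)^2 * cH u" using discriminant[of u] C by simp
  have "u^4 + 4 * u^3 - 2 * u^2 + 4 * u + 1 = cC u + 16 * u" by (simp add: cC_def)
  then have "cH u > 0" using u(1) C by (simp add: cH_def)
  then have "(cA u)^2 > 0" unfolding e using B by simp
  then have A: "cA u \<noteq> 0" by auto
  \<comment> \<open>Since \<open>C\<close> vanishes at \<open>u\<close>, both \<open>A / B\<close>
    and \<open>- A / B\<close> are square roots of \<open>H\<close>. The first is taken as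
    \<open>v\<close>: it gives the numerator \<open>A + B v = 2 A\<close>, the second would give
    zero.\<close>
  show thesis
  proof
    show "(cA u / cB u)^2 = cH u" using e B by (simp add: power_divide)
    show "cC u = 0" by (rule C)
    show "cA u + cB u * (cA u / cB u) \<noteq> 0" using A B by simp
  qed
qed

text \<open>At such a point only the leading term of \<open>C(z)\<^sup>n r(x)\<close>, \<open>n = deg r\<close>, survives.\<close>

lemma homogenised:
  fixes u v :: real
  assumes "cC u = 0"
  shows "\<exists>p. pull [:r:] * cC fz ^ degree r = to_fract p \<and>
    eval2 of_rat u v p = of_rat (lead_coeff r) * (cA u + cB u * v) ^ degree r"
proof (induction r)
  case 0
  show ?case
    using ring_map.zero[OF ring_map_eval2[OF ring_map_of_rat], of u v]
    by (intro exI[of _ 0]) (simp add: pl.zero)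
next
  case (pCons c r)
  interpret e: ring_map "eval2 of_rat u v" by (intro ring_map_eval2 ring_map_of_rat)
  note ev = e.map_coefficients e.simps eval2_var1[OF ring_map_of_rat] eval2_var2[OF ring_map_of_rat]
    eval2_const[OF ring_map_of_rat] assms
  have step: "pull [:pCons c r:] = to_fract [:[:c:]:] + fx * pull [:r:]"
    by (simp add: eval2_const_poly[OF ring_map_to_fract_const]
      ring_map.poly_map_poly_pCons[OF ring_map_to_fract_const])
  show ?case
  \<comment> \<open>For \<open>r = 0\<close> the degree of \<open>pCons c r\<close> is 0 instead of
    \<open>Suc (degree r)\<close>.\<close>
  proof (cases "r = 0")
    case True
    then show ?thesis
      by (intro exI[of _ "[:[:c:]:]"]) (simp add: eval2_const[OF ring_map_to_fract_const] ev)
  next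
    case False
    obtain p where p: "pull [:r:] * cC fz ^ degree r = to_fract p"
      "eval2 of_rat u v p = of_rat (lead_coeff r) * (cA u + cB u * v) ^ degree r"
      using pCons.IH by blast
    \<comment> \<open>Homogenised Horner step:
      \<open>C^(n+1) (c + x r) = c C^(n+1) + (C x) (C^n r)\<close> with
      \<open>C x = A + B w\<close>. The first summand vanishes where \<open>C\<close> does.\<close>
    let ?q = "[:[:c:]:] * cC var1 ^ Suc (degree r) + (cA var1 + cB var1 * var2) * p"
    have "pull [:pCons c r:] * cC fz ^ Suc (degree r) =
      to_fract [:[:c:]:] * cC fz ^ Suc (degree r) + (cC fz * fx) * (pull [:r:] * cC fz ^ degree r)"
      unfolding step by (simp add: algebra_simps)
    also have "\<dots> = to_fract ?q"
      unfolding p(1) cC_fx by (simp only: tf.map_coefficients tf.simps)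
    finally have "pull [:pCons c r:] * cC fz ^ Suc (degree r) = to_fract ?q" .
    moreover have "eval2 of_rat u v ?q = (cA u + cB u * v) * eval2 of_rat u v p"
      unfolding ev by simp
    ultimately show ?thesis
      using False p(2) by (intro exI[of _ ?q]) simp
  qed
qed

text \<open>Clearing denominators turns \<open>r(x)\<close> into a polynomial in \<open>z\<close>
  and \<open>w\<close>. At the pole its value is the leading coefficient of \<open>r\<close> times a
  power of a nonzero number, so \<open>Ks\<close> does not divide it.\<close>

lemma fx_transcendental:
  assumes "pull [:r:] \<in> vanishing_ideal Ks"
  shows "r = 0"
proof (rule ccontr)
  assume "r \<noteq> 0"
  obtain u v :: real where uv: "v^2 = cH u" "cC u = 0" "cA u + cB u * v \<noteq> 0" by (rule pole_exists)
  obtain p where p: "pull [:r:] * cC fz ^ degree r = to_fract p"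
    "eval2 of_rat u v p = of_rat (lead_coeff r) * (cA u + cB u * v) ^ degree r"
    using homogenised[OF uv(2)] by blast
  have "\<not> Ks dvd p" using uv \<open>r \<noteq> 0\<close> p(2) by (intro not_Ks_dvd[of v u]) auto
  moreover have "cC fz ^ degree r \<in> O_Ks" unfolding cC_def by (intro O_Ks_intros)
  then have "to_fract p \<in> vanishing_ideal Ks"
    using vanishing_ideal_mult[OF irreducible_Ks assms] unfolding p(1)[symmetric]
    by (simp add: mult.commute)
  ultimately show False by (simp add: to_fract_in_vanishing_ideal_iff[OF irreducible_Ks])
qed

text \<open>The kernel contains \<open>K3\<close> but, by \<open>fx_transcendental\<close>, no
  nonzero polynomial in \<open>x\<close> alone; as \<open>K3\<close> is irreducible, only
  \<open>(K3)\<close> is left.\<close>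

lemma pull_vanishes_iff: "pull a \<in> vanishing_ideal Ks \<longleftrightarrow> K3 dvd a"
proof
  assume "pull a \<in> vanishing_ideal Ks"
  show "K3 dvd a"
  proof (rule irreducible_dvd_of_no_constants[where P = "\<lambda>a. pull a \<in> vanishing_ideal Ks"])
    show "degree K3 > 0" by (simp add: K3_coeffs)
    show "pull (a - b) \<in> vanishing_ideal Ks"
      if "pull a \<in> vanishing_ideal Ks" "pull b \<in> vanishing_ideal Ks" for a b
      using that by (simp add: pl.diff vanishing_ideal_diff[OF irreducible_Ks])
    show "pull (b * a) \<in> vanishing_ideal Ks" if "pull a \<in> vanishing_ideal Ks" for a b
      using vanishing_ideal_mult[OF irreducible_Ks that pull_in] by (simp add: pl.mult)
  qed (fact irreducible_K3 pull_K3 fx_transcendental \<open>pull a \<in> vanishing_ideal Ks\<close>)+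
next
  assume "K3 dvd a"
  then obtain b where "a = b * K3" by (metis dvdE mult.commute)
  then show "pull a \<in> vanishing_ideal Ks"
    using vanishing_ideal_mult[OF irreducible_Ks pull_K3 pull_in] by (simp add: pl.mult)
qed

section \<open>Surjectivity: recovering \<open>z\<close> and \<open>w\<close> from \<open>x\<close>
  and \<open>y\<close>\<close>

interpretation dm: dominant_map pull K3 Ks
proof
  show "pull [:[:c:]:] = Fract [:[:c:]:] 1" for c
    unfolding eval2_const[OF ring_map_to_fract_const] by (simp add: to_fract_def)
qed (fact irreducible_K3 irreducible_Ks pull_in pull_vanishes_iff)+

text \<open>On the curve \<open>z = - (P1 + P2) / P2\<close>, by \<open>cP_identity\<close> and the
  vanishing of \<open>cPhi\<close>.\<close>

lemma fz_attained: "dm.attained fz"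
proof -
  let ?s = "pull (cP1 var1 var2)" and ?t = "pull (cP2 var1 var2)"
  \<comment> \<open>\<open>P2\<close> is nonzero of degree one in \<open>y\<close>, while
    \<open>K3\<close> has degree four.\<close>
  have "\<not> K3 dvd cP2 var1 var2"
  proof
    have e: "cP2 var1 var2 = [:[:-2, -6, 0, -2, -2:], [:1, 2, 3:]:]"
      by (simp add: cP2_def var1_def var2_def power_numeral_even power_numeral_odd numeral_poly,
        subst one_pCons, simp)
    assume "K3 dvd cP2 var1 var2"
    then have "degree K3 \<le> degree (cP2 var1 var2)" by (rule dvd_imp_degree_le) (simp add: e)
    then show False by (simp add: e K3_coeffs)
  qed
  then have t: "?t \<notin> vanishing_ideal Ks" by (simp add: pull_vanishes_iff)
  have "?s + (fz + 1) * ?t \<in> vanishing_ideal Ks"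
  proof (rule multiple_of_cPhi_vanishes)
    show "(fz + 3)^2 * (?s + (fz + 1) * ?t) = (- 2 * fx^2) * cPhi fx fz"
      unfolding eval2_cP1[OF ring_map_to_fract_const] eval2_cP2[OF ring_map_to_fract_const]
      by (rule cP_identity[OF fy_mult])
    show "- 2 * fx^2 \<in> O_Ks" by (intro O_Ks_intros fx_in)
  qed
  then have "inverse ?t * (?s + (fz + 1) * ?t) \<in> vanishing_ideal Ks"
    by (intro vanishing_ideal_mult[OF irreducible_Ks] local_ring_inverse[OF irreducible_Ks] pull_in t)
  moreover have "inverse ?t * (?s + (fz + 1) * ?t) = fz - - (?s + ?t) * inverse ?t"
  proof -
    have "?t \<noteq> 0" using t vanishing_ideal_zero[OF irreducible_Ks] by metis
    then show ?thesis by (simp add: field_simps)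
  qed
  ultimately have "fz - - (?s + ?t) * inverse ?t \<in> vanishing_ideal Ks" by simp
  moreover have "dm.attained (- (?s + ?t) * inverse ?t)"
    by (intro dm.attained_mult dm.attained_uminus dm.attained_add dm.attained_inverse
      dm.attained_image t)
  ultimately show ?thesis by (rule dm.attained_cong[rotated])
qed

text \<open>\<open>C x = A + B w\<close> is solved for \<open>w\<close>: \<open>z\<close> and
  \<open>x\<close> are attained, and \<open>B\<close> does not vanish on the curve.\<close>

lemma fw_attained: "dm.attained fw"
proof -
  have n: "dm.attained (numeral k)" for k
    using dm.attained_image[of "numeral k"] by (simp add: pl.numeral)
  have p: "dm.attained (fz ^ k)" for k
    using dm.attained_image[of 1] by (induction k) (simp_all add: pl.one dm.attained_mult fz_attained)
  have x: "dm.attained fx"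
    using dm.attained_image[of var1] by (simp add: eval2_var1[OF ring_map_to_fract_const])
  have o: "dm.attained 1" using p[of 0] by simp
  have "fw = (cC fz * fx - cA fz) * inverse (cB fz)"
    unfolding cC_fx using denominators_nonzero by (simp add: field_simps)
  moreover have "dm.attained (cC fz * fx - cA fz)" "dm.attained (cB fz)"
    unfolding cA_def cB_def cC_def
    by (intro dm.attained_mult dm.attained_diff dm.attained_add n p x o fz_attained)+
  ultimately show ?thesis
    using dm.attained_mult dm.attained_inverse denominators_nonvanishing(2) by simp
qed

theorem theorem3p3:
  shows "birational_over_Q K3 Ks"
  by (rule dm.birational_over_QI[OF fz_attained fw_attained])

end
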